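(* Let $\mathscr{H}$ be a reproducing kernel Hilbert space on a non-empty set $\mathscr{X}$, let $\theta\in[0,\frac{\pi}{2})$ and let $T\in\Pi^{\mathbf{Ber}}_{\theta}$. Then $$\big\||T|^2\big\|_{ber}\ \le\ \frac14(\sin\theta+1)^2\,\mathbf{ber}^2(T)+\frac12\inf_{t\in\mathbb{R}}\Big(\big\||T-tI|^2\big\|_{ber}+\big\||T-itI|^2\big\|_{ber}\Big).$$
   Context: $\mathscr{H}$ is a complex separable reproducing kernel Hilbert space of complex-valued functions on a non-empty set $\mathscr{X}$: for every $\lambda\in\mathscr{X}$ evaluation at $\lambda$ is continuous, and $k_\lambda\in\mathscr{H}$ denotes the reproducing kernel, $\phi(\lambda)=\langle\phi,k_\lambda\rangle$ for all $\phi\in\mathscr{H}$. It is implicit that $k_\lambda\neq0$, and $\hat k_\lambda=k_\lambda/\|k_\lambda\|$. $\mathscr{B}(\mathscr{H})$ is the algebra of bounded linear operators on $\mathscr{H}$ and $I$ is the identity. For $A\in\mathscr{B}(\mathscr{H})$: $|A|=(A^*A)^{1/2}$; the Berezin transform is $\widetilde A(\lambda)=\langle A\hat k_\lambda,\hat k_\lambda\rangle$; the Berezin range is $\mathbf{Ber}(A)=\{\widetilde A(\lambda):\lambda\in\mathscr{X}\}$; the Berezin number is $\mathbf{ber}(A)=\sup_{\lambda\in\mathscr{X}}|\widetilde A(\lambda)|$, and $\mathbf{ber}^2(A)=(\mathbf{ber}(A))^2$; the Berezin norm is $\|A\|_{ber}=\sup_{\lambda,\mu\in\mathscr{X}}|\langle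 A\hat k_\lambda,\hat k_\mu\rangle|$. For $\theta\in[0,\frac{\pi}{2})$, $S_\theta=\{z\in\mathbb{C}:|\arg z|\le\theta\}$ is the sector with vertex at the origin (vertex included) and semi-angle $\theta$, and $\Pi^{\mathbf{Ber}}_\theta$ is the class of $A\in\mathscr{B}(\mathscr{H})$ with $\mathbf{Ber}(A)\subseteq S_\theta$. A known fact: $\|A\|_{ber}=\mathbf{ber}(A)$ for positive operators $A$. *)

theory Defs
  imports "HOL-Analysis.Analysis"
begin

text \<open>Complex Hilbert spaces. The inner product is linear in its \<^emph>\<open>first\<close> argument.
  The last axiom yields positive definiteness and says that the norm is the induced one.\<close>

class complex_inner = real_normed_vector +
  fixes scaleC :: "complex \<Rightarrow> 'a \<Rightarrow> 'a" (infixr "*\<^sub>C" 75)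
    and cinner :: "'a \<Rightarrow> 'a \<Rightarrow> complex"
  assumes scaleC_add_right: "c *\<^sub>C (x + y) = c *\<^sub>C x + c *\<^sub>C y"
    and scaleC_add_left: "(c + d) *\<^sub>C x = c *\<^sub>C x + d *\<^sub>C x"
    and scaleC_scaleC: "c *\<^sub>C d *\<^sub>C x = (c * d) *\<^sub>C x"
    and scaleC_of_real: "complex_of_real r *\<^sub>C x = r *\<^sub>R x"
    and cinner_add_left: "cinner (x + y) z = cinner x z + cinner y z"
    and cinner_scaleC_left: "cinner (c *\<^sub>C x) y = c * cinner x y"
    and cinner_commute: "cinner x y = cnj (cinner y x)"
    and cinner_self: "cinner x x = complex_of_real ((norm x)\<^sup>2)"

class chilbert_space = complex_inner + complete_space

subclass (in chilbert_space) banach ..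

definition bounded_clinear :: "('h::complex_inner \<Rightarrow> 'h) \<Rightarrow> bool" where
  "bounded_clinear A \<longleftrightarrow> bounded_linear A \<and> (\<forall>c x. A (c *\<^sub>C x) = c *\<^sub>C A x)"

definition cadjoint :: "('h::chilbert_space \<Rightarrow> 'h) \<Rightarrow> ('h \<Rightarrow> 'h)" where
  "cadjoint A = (THE B. \<forall>x y. cinner (A x) y = cinner x (B y))"

definition positive_op :: "('h::complex_inner \<Rightarrow> 'h) \<Rightarrow> bool" where
  "positive_op A \<longleftrightarrow> bounded_clinear A \<and> (\<forall>x. cinner (A x) x \<in> \<real>\<^sub>\<ge>\<^sub>0)"

text \<open>The unique positive square root.\<close>

definition op_sqrt :: "('h::chilbert_space \<Rightarrow> 'h) \<Rightarrow> ('h \<Rightarrow> 'h)" where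
  "op_sqrt A = (THE P. positive_op P \<and> P \<circ> P = A)"

definition op_abs :: "('h::chilbert_space \<Rightarrow> 'h) \<Rightarrow> ('h \<Rightarrow> 'h)" where
  "op_abs A = op_sqrt (cadjoint A \<circ> A)"

text \<open>A Hilbert space of functions on \<open>'x\<close> is presented by its evaluation map:
  \<open>ev \<phi> l\<close> is the value at \<open>l\<close> of the function \<open>\<phi>\<close>. Linearity of \<open>ev\<close> says that the vector
  space operations are the pointwise ones, and injectivity that \<open>\<phi>\<close> is determined by its values.\<close>

definition rep_kernel :: "('h::chilbert_space \<Rightarrow> 'x \<Rightarrow> complex) \<Rightarrow> 'x \<Rightarrow> 'h" where
  "rep_kernel ev l = (THE k. \<forall>\<phi>. ev \<phi> l = cinner \<phi> k)"

locale rkhs =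
  fixes ev :: "'h::chilbert_space \<Rightarrow> 'x \<Rightarrow> complex"
  assumes ev_add: "ev (\<phi> + \<psi>) l = ev \<phi> l + ev \<psi> l"
    and ev_scaleC: "ev (c *\<^sub>C \<phi>) l = c * ev \<phi> l"
    and ev_inj: "inj ev"
    and ev_continuous: "continuous_on UNIV (\<lambda>\<phi>. ev \<phi> l)"
    and separable: "\<exists>D :: 'h set. countable D \<and> closure D = UNIV"
    and rep_kernel_nonzero: "rep_kernel ev l \<noteq> 0"

definition normalized_kernel :: "('h::chilbert_space \<Rightarrow> 'x \<Rightarrow> complex) \<Rightarrow> 'x \<Rightarrow> 'h" where
  "normalized_kernel ev l = rep_kernel ev l /\<^sub>R norm (rep_kernel ev l)"

definition berezin_transform ::
    "('h::chilbert_space \<Rightarrow> 'x \<Rightarrow> complex) \<Rightarrow> ('h \<Rightarrow> 'h) \<Rightarrow> 'x \<Rightarrow> complex" where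
  "berezin_transform ev A l = cinner (A (normalized_kernel ev l)) (normalized_kernel ev l)"

definition berezin_range ::
    "('h::chilbert_space \<Rightarrow> 'x \<Rightarrow> complex) \<Rightarrow> ('h \<Rightarrow> 'h) \<Rightarrow> complex set" where
  "berezin_range ev A = range (berezin_transform ev A)"

definition berezin_number ::
    "('h::chilbert_space \<Rightarrow> 'x \<Rightarrow> complex) \<Rightarrow> ('h \<Rightarrow> 'h) \<Rightarrow> real" where
  "berezin_number ev A = (SUP l. cmod (berezin_transform ev A l))"

definition berezin_norm ::
    "('h::chilbert_space \<Rightarrow> 'x \<Rightarrow> complex) \<Rightarrow> ('h \<Rightarrow> 'h) \<Rightarrow> real" where
  "berezin_norm ev A =
    (SUP (l, m). cmod (cinner (A (normalized_kernel ev l)) (normalized_kernel ev m)))"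

text \<open>The vertex belongs to the sector because \<open>Arg 0 = 0\<close>.\<close>

definition sector :: "real \<Rightarrow> complex set" where
  "sector \<theta> = {z. \<bar>Arg z\<bar> \<le> \<theta>}"

definition berezin_sectorial ::
    "('h::chilbert_space \<Rightarrow> 'x \<Rightarrow> complex) \<Rightarrow> real \<Rightarrow> ('h \<Rightarrow> 'h) set" where
  "berezin_sectorial ev \<theta> = {A. bounded_clinear A \<and> berezin_range ev A \<subseteq> sector \<theta>}"

end

theory Submission
  imports Defs
begin

text \<open>For a unit vector \<open>k\<close>, put \<open>z = \<langle>T k, k\<rangle>\<close>. Expanding the squares gives
  \<open>\<parallel>T k - t k\<parallel>\<^sup>2 / 2 + \<parallel>T k - \<i> t k\<parallel>\<^sup>2 / 2 = \<parallel>T k\<parallel>\<^sup>2 - t (Re z + Im z) + t\<^sup>2\<close>, which is at least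
  \<open>\<parallel>T k\<parallel>\<^sup>2 - (Re z + Im z)\<^sup>2 / 4\<close>; for \<open>z\<close> in the sector, \<open>\<bar>Re z + Im z\<bar> \<le> (1 + sin \<theta>) \<bar>z\<bar>\<close>.
  Since \<open>\<langle>\<bar>A\<bar>\<^sup>2 x, y\<rangle> = \<langle>A x, A y\<rangle>\<close>, the Berezin norm of \<open>\<bar>A\<bar>\<^sup>2\<close> is the supremum of \<open>\<parallel>A k\<parallel>\<^sup>2\<close>
  over normalized kernels \<open>k\<close>. The identity \<open>\<bar>A\<bar>\<^sup>2 = A\<^sup>* A\<close> needs the existence of adjoints and
  the existence and uniqueness of positive square roots.\<close>

section \<open>Inner product algebra and the Cauchy-Schwarz inequality\<close>

lemma scaleC_zero_right [simp]: "c *\<^sub>C 0 = 0"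
  using scaleC_add_right[of c 0 0] by simp

lemma scaleC_minus_right: "c *\<^sub>C (- x) = - (c *\<^sub>C x)"
  using scaleC_add_right[of c x "- x"] by (simp add: eq_neg_iff_add_eq_0 add.commute)

lemma scaleC_diff_right: "c *\<^sub>C (x - y) = c *\<^sub>C x - c *\<^sub>C y"
  using scaleC_add_right[of c x "- y"] by (simp add: scaleC_minus_right)

lemma scaleC_scaleR: "c *\<^sub>C r *\<^sub>R x = r *\<^sub>R c *\<^sub>C x"
  by (simp flip: scaleC_of_real add: scaleC_scaleC mult.commute)

lemma cinner_zero_left [simp]: "cinner 0 y = 0"
  using cinner_add_left[of 0 0 y] by simp

lemma cinner_add_right: "cinner x (y + z) = cinner x y + cinner x z"
  by (metis cinner_add_left cinner_commute complex_cnj_add)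

lemma cinner_scaleC_right: "cinner x (c *\<^sub>C y) = cnj c * cinner x y"
  by (metis cinner_scaleC_left cinner_commute complex_cnj_mult)

lemma cinner_zero_right [simp]: "cinner x 0 = 0"
  using cinner_add_right[of x 0 0] by simp

lemma cinner_minus_left: "cinner (- x) y = - cinner x y"
  using cinner_add_left[of x "- x" y] by (simp add: eq_neg_iff_add_eq_0 add.commute)

lemma cinner_minus_right: "cinner x (- y) = - cinner x y"
  using cinner_add_right[of x y "- y"] by (simp add: eq_neg_iff_add_eq_0 add.commute)

lemma cinner_diff_left: "cinner (x - y) z = cinner x z - cinner y z"
  using cinner_add_left[of x "- y" z] by (simp add: cinner_minus_left)

lemma cinner_diff_right: "cinner x (y - z) = cinner x y - cinner x z"
  using cinner_add_right[of x y "- z"] by (simp add: cinner_minus_right)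

lemma cinner_scaleR_left: "cinner (r *\<^sub>R x) y = of_real r * cinner x y"
  by (simp flip: scaleC_of_real add: cinner_scaleC_left)

lemma cinner_scaleR_right: "cinner x (r *\<^sub>R y) = of_real r * cinner x y"
  by (simp flip: scaleC_of_real add: cinner_scaleC_right)

lemmas cinner_algebra =
  cinner_add_left cinner_add_right cinner_diff_left cinner_diff_right
  cinner_scaleR_left cinner_scaleR_right cinner_scaleC_left cinner_scaleC_right

lemma cinner_right_cong:
  assumes "\<And>x. cinner x u = cinner x v"
  shows "u = v"
proof -
  have "cinner (u - v) (u - v) = 0"
    by (subst cinner_diff_right) (simp add: assms)
  then show ?thesis
    by (simp add: cinner_self)
qed

lemma norm_add_sq: "(norm (x + y))\<^sup>2 = (norm x)\<^sup>2 + 2 * Re (cinner x y) + (norm y)\<^sup>2"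
proof -
  have "complex_of_real ((norm (x + y))\<^sup>2)
      = of_real ((norm x)\<^sup>2) + (cinner x y + cnj (cinner x y)) + of_real ((norm y)\<^sup>2)"
    by (simp only: cinner_self[symmetric] cinner_algebra cinner_commute[symmetric])
      (simp add: algebra_simps)
  then show ?thesis
    by (auto dest: arg_cong[where f = Re])
qed

lemma norm_diff_sq: "(norm (x - y))\<^sup>2 = (norm x)\<^sup>2 - 2 * Re (cinner x y) + (norm y)\<^sup>2"
  using norm_add_sq[of x "- y"] by (simp add: cinner_minus_right)

lemma norm_scaleC: "norm (c *\<^sub>C x) = cmod c * norm x"
proof -
  have "complex_of_real ((norm (c *\<^sub>C x))\<^sup>2) = of_real ((cmod c * norm x)\<^sup>2)"
    by (simp flip: cinner_self
        add: cinner_algebra power_mult_distrib complex_norm_square mult.assoc del: of_real_power)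
  then have "(norm (c *\<^sub>C x))\<^sup>2 = (cmod c * norm x)\<^sup>2"
    using of_real_eq_iff by blast
  then show ?thesis
    by (simp add: power2_eq_iff_nonneg)
qed

lemma cmod_cinner_le: "cmod (cinner x y) \<le> norm x * norm y"
proof (cases "y = 0")
  case False
  \<comment> \<open>\<open>c\<close> is the coefficient of the orthogonal projection of
    \<open>x\<close> onto the line through \<open>y\<close>. Nonnegativity of the squared norm of
    the remainder is the inequality.\<close>
  define c where "c = cinner x y / of_real ((norm y)\<^sup>2)"
  have "Re (cinner x (c *\<^sub>C y)) = (cmod (cinner x y))\<^sup>2 / (norm y)\<^sup>2"
    unfolding c_def cinner_scaleC_right
    by (simp add: cmod_power2 add_divide_distrib flip: power2_eq_square)
  moreover have "(norm (c *\<^sub>C y))\<^sup>2 = (cmod (cinner x y))\<^sup>2 / (norm y)\<^sup>2"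
    using False
    by (simp add: norm_scaleC c_def norm_divide norm_mult power_mult_distrib power_divide field_simps power2_eq_square)
  ultimately have "(norm (x - c *\<^sub>C y))\<^sup>2 = (norm x)\<^sup>2 - (cmod (cinner x y))\<^sup>2 / (norm y)\<^sup>2"
    by (simp add: norm_diff_sq)
  then have "(cmod (cinner x y))\<^sup>2 / (norm y)\<^sup>2 \<le> (norm x)\<^sup>2"
    by (smt (verit) zero_le_power2)
  then have "(cmod (cinner x y))\<^sup>2 \<le> (norm x * norm y)\<^sup>2"
    using False by (simp add: field_simps power_mult_distrib)
  then show ?thesis
    by (rule power2_le_imp_le) simp
qed simp

lemma bounded_linear_cinner_left: "bounded_linear (\<lambda>x. cinner x y)"
  by (rule bounded_linear_intro[where K = "norm y"])
    (simp_all add: cinner_algebra cmod_cinner_le scaleR_conv_of_real)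

lemma bounded_linear_cinner_right: "bounded_linear (\<lambda>y. cinner x y)"
  by (rule bounded_linear_intro[where K = "norm x"])
    (simp_all add: cinner_algebra scaleR_conv_of_real cmod_cinner_le mult.commute[of "norm _" "norm x"])

subsection \<open>Riesz representation and adjoints\<close>

text \<open>First-order condition at a minimum: for small \<open>t\<close> of sign opposite to
  \<open>a\<close> the linear term would outweigh the quadratic one.\<close>

lemma linear_coeff_zero:
  fixes a b :: real
  assumes "\<And>t. 0 \<le> 2 * t * a + t\<^sup>2 * b"
  shows "a = 0"
proof (rule ccontr)
  assume "a \<noteq> 0"
  \<comment> \<open>Any positive \<open>c\<close> with \<open>b < 2 * c\<close> works: at
    \<open>t = - a / c\<close> the expression equals \<open>(a / c)^2 * (b - 2 * c)\<close>.\<close>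
  define c where "c = \<bar>b\<bar> + 1"
  have c: "c > 0" "b < c"
    by (auto simp: c_def)
  have "2 * (- a / c) * a + (- a / c)\<^sup>2 * b = (a / c)\<^sup>2 * (b - 2 * c)"
    using c by (simp add: field_simps power2_eq_square)
  also have "\<dots> < 0"
    using c \<open>a \<noteq> 0\<close> by (intro mult_pos_neg) auto
  finally show False
    using assms[of "- a / c"] by simp
qed

text \<open>The representing vector is the minimiser of \<open>\<parallel>x\<parallel>\<^sup>2 - 2 Re (f x)\<close>.\<close>

lemma riesz:
  fixes f :: "'h::chilbert_space \<Rightarrow> complex"
  assumes f: "bounded_linear f" and fC: "\<And>c x. f (c *\<^sub>C x) = c * f x"
  obtains u where "\<And>x. f x = cinner x u"
proof -
  interpret f: bounded_linear f by fact
  obtain K where K: "\<And>x. cmod (f x) \<le> norm x * K"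
    using f.bounded by blast
  define J where "J x = (norm x)\<^sup>2 - 2 * Re (f x)" for x
  have J_ge: "- K\<^sup>2 \<le> J x" for x
  proof -
    have "Re (f x) \<le> norm x * K"
      using K[of x] complex_Re_le_cmod[of "f x"] by linarith
    then show ?thesis
      using zero_le_power2[of "norm x - K"] unfolding J_def
      by (simp add: power2_diff)
  qed
  then have bdd: "bdd_below (range J)"
    by (auto simp: bdd_below_def)
  define m where "m = (INF x. J x)"
  have m_le: "m \<le> J x" for x
    unfolding m_def using bdd by (intro cINF_lower) auto
  \<comment> \<open>Parallelogram law: evaluating \<open>J\<close> at the midpoint \<open>z\<close>
    makes the linear terms cancel, and \<open>m \<le> J z\<close> then forces near-minimisers to lie
    close together.\<close>
  have par: "(norm (x - y))\<^sup>2 \<le> 2 * (J x - m) + 2 * (J y - m)" for x y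
  proof -
    define z where "z = (1/2) *\<^sub>R (x + y)"
    have "4 * (norm z)\<^sup>2 = (norm (x + y))\<^sup>2"
      by (simp add: z_def power_divide)
    moreover have "Re (f z) = (Re (f x) + Re (f y)) / 2"
      by (simp add: z_def f.add f.scaleR)
    ultimately have "2 * J x + 2 * J y - 4 * J z = (norm (x - y))\<^sup>2"
      unfolding J_def by (simp add: norm_add_sq norm_diff_sq field_simps)
    then show ?thesis
      using m_le[of z] by argo
  qed
  have "\<exists>x. J x < m + 1 / Suc n" for n
  proof (rule ccontr)
    assume "\<not> ?thesis"
    then have "m + 1 / Suc n \<le> m"
      unfolding m_def by (intro cINF_greatest) (auto simp: m_def not_less)
    then show False
      by simp
  qed
  then obtain X where X: "\<And>n. J (X n) < m + 1 / Suc n"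
    by metis
  have "Cauchy X"
  proof (rule metric_CauchyI)
    fix e :: real
    assume "e > 0"
    \<comment> \<open>\<open>par\<close> doubles each of the two excesses over \<open>m\<close>, so
      a bound of \<open>e^2 / 4\<close> on each adds up to \<open>e^2\<close>.\<close>
    obtain N where N: "1 / Suc N < e\<^sup>2 / 4"
      using \<open>e > 0\<close> nat_approx_posE[of "e\<^sup>2 / 4"] by auto
    have X_lt: "J (X n) - m < e\<^sup>2 / 4" if "n \<ge> N" for n
    proof -
      have "1 / Suc n \<le> 1 / Suc N"
        using that by (simp add: frac_le)
      then show ?thesis
        using X[of n] N by linarith
    qed
    have "(norm (X n - X k))\<^sup>2 < e\<^sup>2" if "n \<ge> N" "k \<ge> N" for n k
      using par[of "X n" "X k"] X_lt[OF that(1)] X_lt[OF that(2)] by argo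
    then show "\<exists>M. \<forall>n\<ge>M. \<forall>k\<ge>M. dist (X n) (X k) < e"
      using \<open>e > 0\<close> power2_less_imp_less by (metis dist_norm less_imp_le)
  qed
  then obtain u where u: "X \<longlonglongrightarrow> u"
    using Cauchy_convergent convergent_def by blast
  have "(\<lambda>n. J (X n)) \<longlonglongrightarrow> J u"
    unfolding J_def by (intro tendsto_intros f.tendsto u)
  moreover have "(\<lambda>n. m + 1 / Suc n) \<longlonglongrightarrow> m + 0"
    by (intro tendsto_intros LIMSEQ_Suc[OF lim_1_over_n])
  ultimately have "J u \<le> m + 0"
    using X by (intro LIMSEQ_le) (auto intro: less_imp_le)
  then have min: "J u \<le> J x" for x
    using m_le[of x] by simp
  \<comment> \<open>The first variation of \<open>J\<close> at its minimiser \<open>u\<close>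
    vanishes in every direction \<open>x\<close>.\<close>
  have re: "Re (cinner x u) = Re (f x)" for x
  proof -
    have "Re (cinner x u) - Re (f x) = 0"
    proof (rule linear_coeff_zero)
      fix t :: real
      have "J (u + t *\<^sub>R x) - J u = 2 * t * (Re (cinner u x) - Re (f x)) + t\<^sup>2 * (norm x)\<^sup>2"
        unfolding J_def
        by (simp add: norm_add_sq f.add f.scaleR cinner_algebra power_mult_distrib algebra_simps)
      moreover have "Re (cinner u x) = Re (cinner x u)"
        by (subst cinner_commute) simp
      ultimately show "0 \<le> 2 * t * (Re (cinner x u) - Re (f x)) + t\<^sup>2 * (norm x)\<^sup>2"
        using min[of "u + t *\<^sub>R x"] by simp
    qed
    then show ?thesis
      by simp
  qed
  have "f x = cinner x u" for x
  proof (rule complex_eqI)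
    \<comment> \<open>Multiplying the argument by \<i> turns imaginary parts into real ones, up to
      sign.\<close>
    show "Im (f x) = Im (cinner x u)"
      using re[of "\<i> *\<^sub>C x"] by (simp add: fC cinner_algebra)
  qed (simp add: re)
  then show ?thesis
    by (rule that)
qed

lemma bounded_clinear_scaleC: "bounded_clinear A \<Longrightarrow> A (c *\<^sub>C x) = c *\<^sub>C A x"
  by (simp add: bounded_clinear_def)

lemma bounded_clinear_bounded_linear: "bounded_clinear A \<Longrightarrow> bounded_linear A"
  by (simp add: bounded_clinear_def)

lemmas bounded_clinear_simps =
  bounded_clinear_scaleC
  linear_add[OF bounded_linear.linear[OF bounded_clinear_bounded_linear]]
  linear_diff[OF bounded_linear.linear[OF bounded_clinear_bounded_linear]]
  linear_scale[OF bounded_linear.linear[OF bounded_clinear_bounded_linear]]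

lemma bounded_clinearI:
  assumes "\<And>x y. A (x + y) = A x + A y" "\<And>c x. A (c *\<^sub>C x) = c *\<^sub>C A x"
    and "\<And>x. norm (A x) \<le> K * norm x"
  shows "bounded_clinear A"
  unfolding bounded_clinear_def
proof
  show "bounded_linear A"
  proof (rule bounded_linear_intro[where K = K])
    show "A (r *\<^sub>R x) = r *\<^sub>R A x" for r x
      using assms(2)[of "complex_of_real r" x] by (simp add: scaleC_of_real)
  qed (use assms in \<open>simp_all add: mult.commute\<close>)
qed (use assms in simp)

lemma bounded_clinear_bound:
  assumes "bounded_clinear A"
  obtains K where "0 < K" "\<And>x. norm (A x) \<le> K * norm x"
  using bounded_linear.pos_bounded[OF bounded_clinear_bounded_linear[OF assms]]
  by (metis mult.commute)

text \<open>Riesz representation of \<open>\<lambda>x. cinner (A x) y\<close> supplies a witness for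
  the definite description, and \<open>cinner_right_cong\<close> makes it unique.\<close>

lemma cadjoint:
  fixes A :: "'h::chilbert_space \<Rightarrow> 'h"
  assumes A: "bounded_clinear A"
  shows "cinner (A x) y = cinner x (cadjoint A y)"
proof -
  have "\<exists>u. \<forall>x. cinner (A x) y = cinner x u" for y
  proof -
    have "bounded_linear (\<lambda>x. cinner (A x) y)"
      using bounded_linear_compose[OF bounded_linear_cinner_left
          bounded_clinear_bounded_linear[OF A]] .
    then show ?thesis
      by (rule riesz[of "\<lambda>x. cinner (A x) y"])
        (auto simp: bounded_clinear_scaleC[OF A] cinner_scaleC_left)
  qed
  then obtain B where B: "\<forall>x y. cinner (A x) y = cinner x (B y)"
    by metis
  have "\<forall>x y. cinner (A x) y = cinner x (cadjoint A y)"
    unfolding cadjoint_def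
  proof (rule theI[where a = B])
    fix C
    assume "\<forall>x y. cinner (A x) y = cinner x (C y)"
    then show "C = B"
      using B by (intro ext cinner_right_cong) metis
  qed (fact B)
  then show ?thesis
    by blast
qed

lemma bounded_clinear_cadjoint:
  fixes A :: "'h::chilbert_space \<Rightarrow> 'h"
  assumes A: "bounded_clinear A"
  shows "bounded_clinear (cadjoint A)"
proof -
  note adj = cadjoint[OF A, symmetric]
  obtain K where K: "0 < K" "\<And>x. norm (A x) \<le> K * norm x"
    using bounded_clinear_bound[OF A] by blast
  show ?thesis
  proof (rule bounded_clinearI[where K = K])
    show "cadjoint A (x + y) = cadjoint A x + cadjoint A y" for x y
      by (rule cinner_right_cong) (simp add: adj cinner_add_right)
    show "cadjoint A (c *\<^sub>C x) = c *\<^sub>C cadjoint A x" for c x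
      by (rule cinner_right_cong) (simp add: adj cinner_scaleC_right)
    show "norm (cadjoint A y) \<le> K * norm y" for y
    proof -
      let ?u = "cadjoint A y"
      \<comment> \<open>With \<open>u\<close> the adjoint applied to \<open>y\<close>, <u, u> = <A
        u, y>. Cauchy-Schwarz leaves a common factor \<open>norm u\<close> to cancel.\<close>
      have "(norm ?u)\<^sup>2 = cmod (cinner (A ?u) y)"
        using cinner_self[of ?u] by (simp add: cadjoint[OF A] norm_power)
      also have "\<dots> \<le> norm (A ?u) * norm y"
        by (rule cmod_cinner_le)
      also have "\<dots> \<le> K * norm ?u * norm y"
        by (intro mult_right_mono K) simp
      finally have "norm ?u * norm ?u \<le> norm ?u * (K * norm y)"
        by (simp add: power2_eq_square mult_ac)
      then show ?thesis
        using K by (cases "?u = 0") auto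
    qed
  qed
qed

lemma bounded_clinear_compose:
  assumes "bounded_clinear A" "bounded_clinear B"
  shows "bounded_clinear (A \<circ> B)"
  using assms bounded_linear_compose[of A B] by (simp add: bounded_clinear_def comp_def)

lemma bounded_clinear_shift:
  assumes "bounded_clinear A"
  shows "bounded_clinear (\<lambda>x. A x - c *\<^sub>C x)"
proof -
  obtain K where K: "0 < K" "\<And>x. norm (A x) \<le> K * norm x"
    using bounded_clinear_bound[OF assms] by blast
  show ?thesis
  proof (rule bounded_clinearI[where K = "K + cmod c"])
    show "norm (A x - c *\<^sub>C x) \<le> (K + cmod c) * norm x" for x
      using norm_triangle_ineq4[of "A x" "c *\<^sub>C x"] K(2)[of x]
      by (simp add: norm_scaleC algebra_simps)
  qed (simp_all add: bounded_clinear_simps[OF assms] scaleC_add_right scaleC_diff_right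
      scaleC_scaleC mult.commute)
qed

subsection \<open>Positive square roots\<close>

text \<open>\<open>F\<close> is a polynomial in \<open>B\<close> without constant term, with nonnegative coefficients of sum \<open>a\<close>.\<close>

inductive nonneg_poly ::
    "('h::real_vector \<Rightarrow> 'h) \<Rightarrow> ('h \<Rightarrow> 'h) \<Rightarrow> real \<Rightarrow> bool" for B where
  zero: "nonneg_poly B (\<lambda>x. 0) 0"
| var: "nonneg_poly B B 1"
| add: "nonneg_poly B F a \<Longrightarrow> nonneg_poly B G b \<Longrightarrow> nonneg_poly B (\<lambda>x. F x + G x) (a + b)"
| mult: "nonneg_poly B F a \<Longrightarrow> nonneg_poly B G b \<Longrightarrow> nonneg_poly B (\<lambda>x. F (G x)) (a * b)"
| scale: "nonneg_poly B F a \<Longrightarrow> 0 \<le> r \<Longrightarrow> nonneg_poly B (\<lambda>x. r *\<^sub>R F x) (r * a)"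

lemma nonneg_poly_value_nonneg: "nonneg_poly B F a \<Longrightarrow> 0 \<le> a"
  by (induction rule: nonneg_poly.induct) auto

text \<open>Powers of a contraction are contractions, so by the triangle inequality each coefficient
  contributes at most its own value.\<close>

lemma nonneg_poly_norm_le:
  fixes B :: "'h::real_normed_vector \<Rightarrow> 'h"
  assumes "nonneg_poly B F a" "\<And>x. norm (B x) \<le> norm x"
  shows "norm (F x) \<le> a * norm x"
  using assms(1)
proof (induction arbitrary: x rule: nonneg_poly.induct)
  case (add F a G b)
  then show ?case
    by (metis add_mono distrib_right norm_triangle_mono)
next
  case (mult F a G b)
  have "norm (F (G x)) \<le> a * norm (G x)"
    by (rule mult)
  also have "\<dots> \<le> a * (b * norm x)"
    using mult nonneg_poly_value_nonneg by (intro mult_left_mono) auto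
  finally show ?case
    by (simp add: mult_ac)
next
  case (scale F a r)
  then show ?case
    using mult_left_mono[of "norm (F x)" "a * norm x" r] by (simp add: mult_ac)
qed (use assms(2) in auto)

lemma nonneg_poly_bounded_clinear:
  assumes "nonneg_poly B F a" "bounded_clinear B" "\<And>x. norm (B x) \<le> norm x"
  shows "bounded_clinear F"
proof -
  have "(\<forall>x y. F (x + y) = F x + F y) \<and> (\<forall>c x. F (c *\<^sub>C x) = c *\<^sub>C F x)"
    using assms(1)
    by (induction rule: nonneg_poly.induct)
      (auto simp: bounded_clinear_simps[OF assms(2)] scaleC_add_right scaleC_scaleR algebra_simps)
  then show ?thesis
    using nonneg_poly_norm_le[OF assms(1,3)] by (intro bounded_clinearI) auto
qed

lemma nonneg_poly_commute:
  fixes B C :: "'h::real_normed_vector \<Rightarrow> 'h"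
  assumes "nonneg_poly B F a" "bounded_linear C" "\<And>x. C (B x) = B (C x)"
  shows "C (F x) = F (C x)"
proof -
  interpret C: bounded_linear C by fact
  show ?thesis
    using assms(1) by (induction arbitrary: x rule: nonneg_poly.induct)
      (auto simp: C.zero C.add C.scaleR assms(3))
qed

lemma nonneg_poly_symmetric:
  assumes "nonneg_poly B F a" "bounded_clinear B" "\<And>x. norm (B x) \<le> norm x"
    and "\<And>x y. cinner (B x) y = cinner x (B y)"
  shows "cinner (F x) y = cinner x (F y)"
  using assms(1)
proof (induction arbitrary: x y rule: nonneg_poly.induct)
  case (mult F a G b)
  have "bounded_linear G"
    using nonneg_poly_bounded_clinear[OF mult.hyps(2) assms(2,3)]
    by (rule bounded_clinear_bounded_linear)
  \<comment> \<open>A product of symmetric maps is symmetric once they commute. Commutation is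
    obtained in two rounds: \<open>G\<close> with \<open>B\<close>, hence \<open>G\<close> with the
    polynomial \<open>F\<close> in \<open>B\<close>.\<close>
  moreover have "G (B x) = B (G x)" for x
    using nonneg_poly_commute[OF mult.hyps(2) bounded_clinear_bounded_linear[OF assms(2)]] by simp
  ultimately have "G (F y) = F (G y)"
    by (rule nonneg_poly_commute[OF mult.hyps(1)])
  then show ?case
    by (simp add: mult.IH)
qed (simp_all add: cinner_algebra assms(4))

text \<open>The fixed point \<open>Y\<close> of this iteration satisfies \<open>(I - Y)\<^sup>2 = I - B\<close>. All iterates and their
  differences are polynomials in \<open>B\<close> with nonnegative coefficients, so for a contraction \<open>B\<close>
  convergence is governed by the scalar case \<open>B = 1\<close>.\<close>

primrec sqrt_iter :: "('h::real_vector \<Rightarrow> 'h) \<Rightarrow> nat \<Rightarrow> 'h \<Rightarrow> 'h" where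
  "sqrt_iter B 0 = (\<lambda>x. 0)"
| "sqrt_iter B (Suc n) = (\<lambda>x. (1/2) *\<^sub>R (B x + sqrt_iter B n (sqrt_iter B n x)))"

primrec sqrt_iter_val :: "nat \<Rightarrow> real" where
  "sqrt_iter_val 0 = 0"
| "sqrt_iter_val (Suc n) = 1/2 * (1 + sqrt_iter_val n * sqrt_iter_val n)"

lemma sqrt_iter_val_nonneg: "0 \<le> sqrt_iter_val n"
  by (induction n) auto

lemma sqrt_iter_val_le_1: "sqrt_iter_val n \<le> 1"
proof (induction n)
  case (Suc n)
  then show ?case
    using mult_mono[OF Suc Suc] sqrt_iter_val_nonneg[of n] by simp
qed simp

lemma nonneg_poly_sqrt_iter: "nonneg_poly B (sqrt_iter B n) (sqrt_iter_val n)"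
proof (induction n)
  case 0
  show ?case
    using nonneg_poly.zero by simp
next
  case (Suc n)
  show ?case
    unfolding sqrt_iter.simps sqrt_iter_val.simps
    by (intro nonneg_poly.scale nonneg_poly.add nonneg_poly.var nonneg_poly.mult Suc) simp
qed

text \<open>Subtracting consecutive recursions cancels \<open>B\<close>. The identity Z^2 - Y^2 = (Z
  - Y) Z + Y (Z - Y) then builds the next difference from the previous one using only sums, products
  and the factor 1/2.\<close>

lemma nonneg_poly_sqrt_iter_step:
  assumes "bounded_clinear B" "\<And>x. norm (B x) \<le> norm x"
  shows "nonneg_poly B (\<lambda>x. sqrt_iter B (Suc n) x - sqrt_iter B n x)
    (sqrt_iter_val (Suc n) - sqrt_iter_val n)"
proof (induction n)
  case 0
  show ?case
    using nonneg_poly.scale[OF nonneg_poly.var[of B], of "1/2"] by simp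
next
  case (Suc n)
  let ?Y = "sqrt_iter B n" and ?Z = "sqrt_iter B (Suc n)"
  let ?y = "sqrt_iter_val n" and ?z = "sqrt_iter_val (Suc n)"
  note diff = bounded_clinear_simps(3)[OF nonneg_poly_bounded_clinear[OF nonneg_poly_sqrt_iter assms]]
  let ?D = "\<lambda>x. ?Z x - ?Y x"
  have "nonneg_poly B (\<lambda>x. (1/2) *\<^sub>R (?D (?Z x) + ?Y (?D x)))
      (1/2 * ((?z - ?y) * ?z + ?y * (?z - ?y)))"
    by (intro nonneg_poly.scale nonneg_poly.add nonneg_poly_sqrt_iter Suc
        nonneg_poly.mult[where F = ?D and G = ?Z] nonneg_poly.mult[where F = ?Y and G = ?D]) simp
  moreover have "(\<lambda>x. (1/2) *\<^sub>R (?D (?Z x) + ?Y (?D x)))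
      = (\<lambda>x. sqrt_iter B (Suc (Suc n)) x - sqrt_iter B (Suc n) x)"
    unfolding sqrt_iter.simps(2)[of B "Suc n"]
    unfolding diff
    unfolding sqrt_iter.simps(2)[of B n]
    by (rule ext) (simp add: algebra_simps)
  moreover have "1/2 * ((?z - ?y) * ?z + ?y * (?z - ?y)) = sqrt_iter_val (Suc (Suc n)) - ?z"
    unfolding sqrt_iter_val.simps(2)[of "Suc n"]
    unfolding sqrt_iter_val.simps(2)[of n]
    by (simp add: algebra_simps)
  ultimately show ?case
    by metis
qed

lemma nonneg_poly_sqrt_iter_diff:
  assumes "bounded_clinear B" "\<And>x. norm (B x) \<le> norm x" "n \<le> m"
  shows "nonneg_poly B (\<lambda>x. sqrt_iter B m x - sqrt_iter B n x)
    (sqrt_iter_val m - sqrt_iter_val n)"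
  using \<open>n \<le> m\<close>
proof (induction m rule: dec_induct)
  case base
  show ?case
    using nonneg_poly.zero by simp
next
  case (step m)
  from nonneg_poly.add[OF nonneg_poly_sqrt_iter_step[OF assms(1,2), of m] step.IH]
  show ?case
    by simp
qed

text \<open>The norm of a difference of iterates is at most the difference of the scalar values
  times \<open>norm x\<close>, and the scalar sequence is increasing and bounded by 1. Its
  monotonicity is read off from the nonnegative coefficient sums of the differences.\<close>

lemma sqrt_iter_Cauchy:
  assumes "bounded_clinear B" "\<And>x. norm (B x) \<le> norm x"
  shows "Cauchy (\<lambda>n. sqrt_iter B n x)"
proof -
  have "incseq sqrt_iter_val"
    using nonneg_poly_value_nonneg[OF nonneg_poly_sqrt_iter_diff[OF assms]]
    by (intro monoI) simp
  then obtain l where "sqrt_iter_val \<longlonglongrightarrow> l"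
    using sqrt_iter_val_le_1 incseq_convergent by blast
  then have "Cauchy (\<lambda>n. sqrt_iter_val n * norm x)"
    by (intro convergent_Cauchy) (auto simp: convergent_def intro!: exI tendsto_intros)
  have le: "dist (sqrt_iter B m x) (sqrt_iter B n x)
      \<le> dist (sqrt_iter_val m * norm x) (sqrt_iter_val n * norm x)" if "n \<le> m" for m n
    using nonneg_poly_norm_le[OF nonneg_poly_sqrt_iter_diff[OF assms that] assms(2), of x]
    unfolding dist_norm real_norm_def left_diff_distrib by linarith
  show ?thesis
    unfolding Cauchy_altdef
  proof (intro allI impI)
    fix e :: real
    assume "e > 0"
    then obtain N where N: "\<And>m n. m \<ge> N \<Longrightarrow> n > m \<Longrightarrow>
        dist (sqrt_iter_val m * norm x) (sqrt_iter_val n * norm x) < e"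
      using \<open>Cauchy (\<lambda>n. sqrt_iter_val n * norm x)\<close> unfolding Cauchy_altdef by blast
    have "dist (sqrt_iter B m x) (sqrt_iter B n x) < e" if "m \<ge> N" "n > m" for m n
      using le[of m n] N[OF that] that(2) by (simp only: dist_commute) linarith
    then show "\<exists>N. \<forall>m\<ge>N. \<forall>n>m. dist (sqrt_iter B m x) (sqrt_iter B n x) < e"
      by blast
  qed
qed

text \<open>\<open>R\<close> is I - Y for the pointwise limit Y of the iterates; Y = (B + Y^2) / 2
  rearranges to (I - Y)^2 = I - B. The commutation clause is what later yields uniqueness of square
  roots.\<close>

lemma contraction_sqrt:
  fixes B :: "'h::chilbert_space \<Rightarrow> 'h"
  assumes B: "bounded_clinear B" "\<And>x. norm (B x) \<le> norm x"
    and sym: "\<And>x y. cinner (B x) y = cinner x (B y)"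
  obtains R where "positive_op R" "\<And>x. R (R x) = x - B x"
    "\<And>C x. bounded_linear C \<Longrightarrow> (\<And>x. C (B x) = B (C x)) \<Longrightarrow> C (R x) = R (C x)"
proof -
  define Y where "Y x = lim (\<lambda>n. sqrt_iter B n x)" for x
  have lim: "(\<lambda>n. sqrt_iter B n x) \<longlonglongrightarrow> Y x" for x
    unfolding Y_def using Cauchy_convergent[OF sqrt_iter_Cauchy[OF B]]
    by (simp add: convergent_LIMSEQ_iff)
  note poly = nonneg_poly_sqrt_iter[of B]
  have lin: "bounded_clinear (sqrt_iter B n)" for n
    by (rule nonneg_poly_bounded_clinear[OF poly B])
  have norm_iter: "norm (sqrt_iter B n x) \<le> norm x" for n x
  proof -
    have "norm (sqrt_iter B n x) \<le> sqrt_iter_val n * norm x"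
      by (rule nonneg_poly_norm_le[OF poly B(2)])
    also have "\<dots> \<le> 1 * norm x"
      by (intro mult_right_mono sqrt_iter_val_le_1) simp
    finally show ?thesis
      by simp
  qed
  have norm_Y: "norm (Y x) \<le> norm x" for x
    using tendsto_norm[OF lim] by (rule LIMSEQ_le_const2) (auto intro: norm_iter)
  have Y: "bounded_clinear Y"
  proof (rule bounded_clinearI[where K = 1])
    show "Y (x + y) = Y x + Y y" for x y
      using tendsto_add[OF lim lim] LIMSEQ_unique[OF lim[of "x + y"]]
      by (simp add: bounded_clinear_simps[OF lin])
    show "Y (c *\<^sub>C x) = c *\<^sub>C Y x" for c x
    proof -
      have "bounded_linear (\<lambda>x::'h. c *\<^sub>C x)"
        by (rule bounded_linear_intro[where K = "cmod c"])
          (simp_all add: scaleC_add_right scaleC_scaleR norm_scaleC mult.commute)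
      then have "(\<lambda>n. c *\<^sub>C sqrt_iter B n x) \<longlonglongrightarrow> c *\<^sub>C Y x"
        by (rule bounded_linear.tendsto) (rule lim)
      then show ?thesis
        using LIMSEQ_unique[OF lim[of "c *\<^sub>C x"]] by (simp add: bounded_clinear_simps[OF lin])
    qed
  qed (simp add: norm_Y)
  have Y_sym: "cinner (Y x) y = cinner x (Y y)" for x y
  proof (rule LIMSEQ_unique)
    show "(\<lambda>n. cinner (sqrt_iter B n x) y) \<longlonglongrightarrow> cinner (Y x) y"
      by (intro bounded_linear.tendsto[OF bounded_linear_cinner_left] lim)
    show "(\<lambda>n. cinner (sqrt_iter B n x) y) \<longlonglongrightarrow> cinner x (Y y)"
      unfolding nonneg_poly_symmetric[OF poly B sym]
      by (intro bounded_linear.tendsto[OF bounded_linear_cinner_right] lim)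
  qed
  \<comment> \<open>The limit passes through the composition because the iterates are uniformly
    contractive: split off \<open>sqrt_iter B n\<close> applied to the null sequence
    \<open>sqrt_iter B n x - Y x\<close>.\<close>
  have YY: "(\<lambda>n. sqrt_iter B n (sqrt_iter B n x)) \<longlonglongrightarrow> Y (Y x)" for x
  proof -
    have "(\<lambda>n. sqrt_iter B n (sqrt_iter B n x - Y x)) \<longlonglongrightarrow> 0"
    proof (rule Lim_null_comparison)
      show "(\<lambda>n. norm (sqrt_iter B n x - Y x)) \<longlonglongrightarrow> 0"
        using lim[of x] by (simp add: LIM_zero tendsto_norm_zero)
    qed (intro always_eventually allI norm_iter)
    from tendsto_add[OF this lim[of "Y x"]] show ?thesis
      by (simp add: bounded_clinear_simps[OF lin])
  qed
  have fix_Y: "2 *\<^sub>R Y x = B x + Y (Y x)" for x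
  proof -
    have "(\<lambda>n. (1/2) *\<^sub>R (B x + sqrt_iter B n (sqrt_iter B n x)))
        \<longlonglongrightarrow> (1/2) *\<^sub>R (B x + Y (Y x))"
      by (intro tendsto_intros YY)
    with LIMSEQ_Suc[OF lim[of x]] have "Y x = (1/2) *\<^sub>R (B x + Y (Y x))"
      unfolding sqrt_iter.simps by (rule LIMSEQ_unique)
    then have "2 *\<^sub>R Y x = 2 *\<^sub>R (1/2) *\<^sub>R (B x + Y (Y x))"
      by (rule arg_cong)
    then show ?thesis
      by simp
  qed
  define R where "R x = x - Y x" for x
  show ?thesis
  proof (rule that[of R])
    show "positive_op R"
      unfolding positive_op_def
    proof (intro conjI allI)
      show "bounded_clinear R"
        using bounded_clinear_bounded_linear[OF Y]
        unfolding R_def bounded_clinear_def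
        by (auto simp: bounded_clinear_simps[OF Y] scaleC_diff_right intro: bounded_linear_sub)
      fix x
      have "cinner (Y x) x = cnj (cinner (Y x) x)"
        using Y_sym cinner_commute by metis
      then have "Im (cinner (Y x) x) = 0"
        by (simp add: complex_eq_iff)
      \<comment> \<open>Positivity of I - Y comes from Y being a contraction, via
        Cauchy-Schwarz.\<close>
      moreover have "Re (cinner (Y x) x) \<le> (norm x)\<^sup>2"
      proof -
        have "Re (cinner (Y x) x) \<le> norm (Y x) * norm x"
          using cmod_cinner_le complex_Re_le_cmod order_trans by blast
        also have "\<dots> \<le> norm x * norm x"
          by (intro mult_right_mono norm_Y) simp
        finally show ?thesis
          by (simp add: power2_eq_square)
      qed
      ultimately show "cinner (R x) x \<in> \<real>\<^sub>\<ge>\<^sub>0"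
        by (simp add: R_def cinner_diff_left cinner_self complex_nonneg_Reals_iff flip: of_real_power)
    qed
    show "R (R x) = x - B x" for x
      using fix_Y[of x] by (simp add: R_def bounded_clinear_simps[OF Y] scaleR_2 algebra_simps)
    show "C (R x) = R (C x)" if C: "bounded_linear C" "\<And>x. C (B x) = B (C x)" for C x
    proof -
      have "(\<lambda>n. C (sqrt_iter B n x)) \<longlonglongrightarrow> C (Y x)"
        by (intro bounded_linear.tendsto[OF C(1)] lim)
      then have "C (Y x) = Y (C x)"
        unfolding nonneg_poly_commute[OF poly C] using lim LIMSEQ_unique by blast
      then show ?thesis
        by (simp add: R_def linear_diff[OF bounded_linear.linear[OF C(1)]])
    qed
  qed
qed

section \<open>Positive operators: symmetry, norm bounds, existence and uniqueness of square
  roots\<close>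

text \<open>Complex polarization: the sesquilinear defect \<open>D\<close> vanishes on the diagonal
  because the quadratic form is real. Expanding at \<open>x + y\<close> and at x + \<i> y gives two
  equations that force \<open>D x y = 0\<close>.\<close>

lemma positive_op_symmetric:
  assumes "positive_op P"
  shows "cinner (P x) y = cinner x (P y)"
proof -
  note lin = bounded_clinear_simps[of P] and P = assms[unfolded positive_op_def]
  define D where "D x y = cinner (P x) y - cinner x (P y)" for x y
  have D0: "D z z = 0" for z
  proof -
    have "cnj (cinner (P z) z) = cinner (P z) z"
      using P by (auto simp: complex_nonneg_Reals_iff complex_eq_iff)
    then show ?thesis
      unfolding D_def by (metis cinner_commute right_minus_eq)
  qed
  have "D (x + y) (x + y) = D x x + D x y + D y x + D y y"
    "D (x + \<i> *\<^sub>C y) (x + \<i> *\<^sub>C y) = D x x - \<i> * D x y + \<i> * D y x + D y y"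
    using P by (simp_all add: D_def lin cinner_algebra algebra_simps)
  then have "D x y + D y x = 0" "- \<i> * D x y + \<i> * D y x = 0"
    by (simp_all add: D0)
  then have "D x y = 0"
    by (simp add: complex_eq_iff)
  then show ?thesis
    by (simp add: D_def)
qed

text \<open>Positivity is tested on \<open>x - t *\<^sub>R P x\<close>, and the term quadratic in
  \<open>t\<close> is bounded through \<open>K\<close>. In operator form this is P^2 \<le> K
  P.\<close>

lemma positive_op_norm_sq_le:
  assumes P: "positive_op P" and K: "0 < K" "\<And>x. norm (P x) \<le> K * norm x"
  shows "(norm (P x))\<^sup>2 \<le> K * Re (cinner (P x) x)"
proof -
  note lin = bounded_clinear_simps[of P]
  have bl: "bounded_clinear P" and pos: "0 \<le> Re (cinner (P z) z)" for z
    using P by (auto simp: positive_op_def complex_nonneg_Reals_iff)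
  \<comment> \<open>This \<open>t\<close> minimises - 2 t s + t^2 K s for s = ||P x||^2.\<close>
  define t where "t = 1 / K"
  have sq: "cinner (P x) (P x) = of_real ((norm (P x))\<^sup>2)"
    by (rule cinner_self)
  have "Re (cinner (P (P x)) (P x)) \<le> norm (P (P x)) * norm (P x)"
    using cmod_cinner_le complex_Re_le_cmod order_trans by blast
  also have "\<dots> \<le> (K * norm (P x)) * norm (P x)"
    by (intro mult_right_mono K) simp
  finally have PP: "Re (cinner (P (P x)) (P x)) \<le> K * (norm (P x))\<^sup>2"
    by (simp add: power2_eq_square mult.assoc)
  have "0 \<le> Re (cinner (P (x - t *\<^sub>R P x)) (x - t *\<^sub>R P x))"
    by (rule pos)
  also have "\<dots> = Re (cinner (P x) x) - 2 * t * (norm (P x))\<^sup>2 + t\<^sup>2 * Re (cinner (P (P x)) (P x))"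
    using bl by (simp add: lin cinner_algebra positive_op_symmetric[OF P, of "P x" x] sq
        power2_eq_square algebra_simps)
  also have "\<dots> \<le> Re (cinner (P x) x) - 2 * t * (norm (P x))\<^sup>2 + t\<^sup>2 * (K * (norm (P x))\<^sup>2)"
    using PP by (intro add_left_mono mult_left_mono) auto
  also have "\<dots> = Re (cinner (P x) x) - (norm (P x))\<^sup>2 / K"
    using K(1) by (simp add: t_def power2_eq_square field_simps)
  finally show ?thesis
    using K(1) by (simp add: field_simps)
qed

lemma positive_op_eq_0:
  assumes P: "positive_op P" and "Re (cinner (P x) x) = 0"
  shows "P x = 0"
proof -
  obtain K where "0 < K" "\<And>x. norm (P x) \<le> K * norm x"
    using P bounded_clinear_bound unfolding positive_op_def by blast
  from positive_op_norm_sq_le[OF P this, of x] show ?thesis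
    using assms by simp
qed

text \<open>Rescaling makes B = I - S/K a contraction, so \<open>contraction_sqrt\<close> gives a
  root of S/K, which is multiplied by \<open>sqrt K\<close>.\<close>

lemma positive_op_sqrt:
  fixes S :: "'h::chilbert_space \<Rightarrow> 'h"
  assumes S: "positive_op S"
  obtains P where "positive_op P" "\<And>x. P (P x) = S x"
    "\<And>C x. bounded_linear C \<Longrightarrow> (\<And>x. C (S x) = S (C x)) \<Longrightarrow> C (P x) = P (C x)"
proof -
  have bl: "bounded_clinear S"
    using S by (simp add: positive_op_def)
  note lin = bounded_clinear_simps[OF bl]
  obtain K where K: "0 < K" "\<And>x. norm (S x) \<le> K * norm x"
    using bounded_clinear_bound[OF bl] by blast
  define B where "B x = x - (1 / K) *\<^sub>R S x" for x
  \<comment> \<open>||B x||^2 = ||x||^2 - (2/K) <S x, x> + ||S x||^2 / K^2, and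
    \<open>positive_op_norm_sq_le\<close> lets the middle term absorb the last.\<close>
  have B_norm: "norm (B x) \<le> norm x" for x
  proof -
    have re: "Re (cinner x (S x)) = Re (cinner (S x) x)"
      by (simp add: positive_op_symmetric[OF S])
    have "(norm (S x))\<^sup>2 / K\<^sup>2 \<le> (K * Re (cinner (S x) x)) / K\<^sup>2"
      by (intro divide_right_mono positive_op_norm_sq_le[OF S K]) simp
    also have "\<dots> \<le> 2 / K * Re (cinner (S x) x)"
      using K(1) S by (auto simp: power2_eq_square positive_op_def complex_nonneg_Reals_iff field_simps)
    finally have "(norm (B x))\<^sup>2 \<le> (norm x)\<^sup>2"
      by (simp add: B_def norm_diff_sq cinner_algebra re power_mult_distrib power_divide)
    then show ?thesis
      by (rule power2_le_imp_le) simp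
  qed
  have "bounded_clinear B"
    by (rule bounded_clinearI[where K = 1])
      (auto simp: B_norm, auto simp: B_def lin scaleC_diff_right scaleC_scaleR algebra_simps)
  moreover have "cinner (B x) y = cinner x (B y)" for x y
    by (simp add: B_def cinner_algebra positive_op_symmetric[OF S])
  ultimately obtain R where R: "positive_op R" "\<And>x. R (R x) = x - B x"
    "\<And>C x. bounded_linear C \<Longrightarrow> (\<And>x. C (B x) = B (C x)) \<Longrightarrow> C (R x) = R (C x)"
    using contraction_sqrt[of B] B_norm by metis
  have Rbl: "bounded_clinear R"
    using R(1) by (simp add: positive_op_def)
  note Rlin = bounded_clinear_simps[OF Rbl]
  obtain L where L: "0 < L" "\<And>x. norm (R x) \<le> L * norm x"
    using bounded_clinear_bound[OF Rbl] by blast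
  show ?thesis
  proof (rule that[of "\<lambda>x. sqrt K *\<^sub>R R x"])
    have "bounded_clinear (\<lambda>x. sqrt K *\<^sub>R R x)"
      by (rule bounded_clinearI[where K = "sqrt K * L"])
        (use K(1) L in \<open>auto simp: Rlin scaleC_scaleR scaleR_add_right mult.assoc\<close>)
    then show "positive_op (\<lambda>x. sqrt K *\<^sub>R R x)"
      using R(1) K(1)
      by (auto simp: positive_op_def cinner_algebra complex_nonneg_Reals_iff)
    show "sqrt K *\<^sub>R R (sqrt K *\<^sub>R R x) = S x" for x
      using K(1) by (simp add: Rlin R(2) B_def)
    show "C (sqrt K *\<^sub>R R x) = sqrt K *\<^sub>R R (C x)"
      if C: "bounded_linear C" "\<And>x. C (S x) = S (C x)" for C x
    proof -
      interpret C: bounded_linear C by fact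
      have "C (B x) = B (C x)" for x
        by (simp add: B_def C.diff C.scaleR C(2))
      then show ?thesis
        using R(3)[OF C(1)] by (simp add: C.scaleR)
    qed
  qed
qed

text \<open>For y = (P - Q) x, commutation gives (P + Q) y = P^2 x - Q^2 x = 0. Both nonnegative
  forms therefore vanish at y, so P y = Q y = 0.\<close>

lemma positive_op_sqrt_unique:
  fixes P Q S :: "'h::chilbert_space \<Rightarrow> 'h"
  assumes P: "positive_op P" "\<And>x. P (P x) = S x"
    and Q: "positive_op Q" "\<And>x. Q (Q x) = S x"
    and comm: "\<And>x. P (Q x) = Q (P x)"
  shows "P = Q"
proof
  fix x
  have bl: "bounded_clinear P" "bounded_clinear Q"
    using P(1) Q(1) by (simp_all add: positive_op_def)
  note lin = bounded_clinear_simps[OF bl(1)] bounded_clinear_simps[OF bl(2)]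
  define y where "y = P x - Q x"
  have "P y + Q y = 0"
    by (simp add: y_def lin P(2) Q(2) comm)
  then have "Re (cinner (P y) y) + Re (cinner (Q y) y) = 0"
    by (metis cinner_add_left cinner_zero_left plus_complex.simps(1) zero_complex.simps(1))
  moreover have "0 \<le> Re (cinner (P y) y)" "0 \<le> Re (cinner (Q y) y)"
    using P(1) Q(1) by (auto simp: positive_op_def complex_nonneg_Reals_iff)
  ultimately have "P y = 0" "Q y = 0"
    using positive_op_eq_0[OF P(1), of y] positive_op_eq_0[OF Q(1), of y] by auto
  \<comment> \<open>Only the second \<open>y\<close> is unfolded; symmetry moves \<open>P\<close>
    and \<open>Q\<close> onto the first, where they give 0.\<close>
  then have "cinner y y = 0"
    by (subst (2) y_def)
      (simp add: cinner_diff_right flip: positive_op_symmetric[OF P(1)] positive_op_symmetric[OF Q(1)])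
  then show "P x = Q x"
    by (simp add: cinner_self y_def)
qed

text \<open>Any positive root \<open>Q\<close> commutes with S = Q^2, hence with the constructed
  root \<open>P\<close>, so the commuting case of uniqueness identifies them and the definite
  description is justified.\<close>

lemma op_sqrt_square:
  fixes S :: "'h::chilbert_space \<Rightarrow> 'h"
  assumes S: "positive_op S"
  shows "op_sqrt S \<circ> op_sqrt S = S"
proof -
  obtain P where P: "positive_op P" "\<And>x. P (P x) = S x"
    "\<And>C x. bounded_linear C \<Longrightarrow> (\<And>x. C (S x) = S (C x)) \<Longrightarrow> C (P x) = P (C x)"
    using positive_op_sqrt[OF S] by metis
  have "positive_op (op_sqrt S) \<and> op_sqrt S \<circ> op_sqrt S = S"
    unfolding op_sqrt_def
  proof (rule theI[where a = P])
    show "positive_op P \<and> P \<circ> P = S"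
      using P by auto
    fix Q
    assume "positive_op Q \<and> Q \<circ> Q = S"
    then have Q: "positive_op Q" "\<And>x. Q (Q x) = S x"
      by auto
    then have "bounded_linear Q"
      by (simp add: positive_op_def bounded_clinear_def)
    moreover have "Q (S x) = S (Q x)" for x
      by (simp flip: Q(2))
    ultimately have "Q (P x) = P (Q x)" for x
      by (rule P(3))
    then show "Q = P"
      by (rule positive_op_sqrt_unique[OF Q P(1,2)])
  qed
  then show ?thesis
    by blast
qed

section \<open>The square of the modulus of an operator\<close>

lemma op_abs_square:
  fixes A :: "'h::chilbert_space \<Rightarrow> 'h"
  assumes A: "bounded_clinear A"
  shows "op_abs A ^^ 2 = cadjoint A \<circ> A"
proof -
  have "cinner (cadjoint A (A x)) x = of_real ((norm (A x))\<^sup>2)" for x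
    using cadjoint[OF A, of x "A x"] cinner_commute cinner_self
    by (metis complex_cnj_complex_of_real)
  then have "positive_op (cadjoint A \<circ> A)"
    using bounded_clinear_compose[OF bounded_clinear_cadjoint[OF A] A]
    by (simp add: positive_op_def complex_nonneg_Reals_iff del: of_real_power)
  from op_sqrt_square[OF this] show ?thesis
    by (simp add: op_abs_def numeral_2_eq_2)
qed

lemma cinner_op_abs_square:
  fixes A :: "'h::chilbert_space \<Rightarrow> 'h"
  assumes A: "bounded_clinear A"
  shows "cinner ((op_abs A ^^ 2) x) y = cinner (A x) (A y)"
proof -
  have "cinner (cadjoint A (A x)) y = cnj (cinner (A y) (A x))"
    by (subst cinner_commute) (simp add: cadjoint[OF A])
  also have "\<dots> = cinner (A x) (A y)"
    by (rule cinner_commute[symmetric])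
  finally show ?thesis
    by (simp add: op_abs_square[OF A])
qed

subsection \<open>Berezin norms\<close>

lemma norm_normalized_kernel:
  assumes "rkhs ev"
  shows "norm (normalized_kernel ev l) = 1"
  using rkhs.rep_kernel_nonzero[OF assms] by (simp add: normalized_kernel_def)

lemma norm_sq_le_berezin_norm:
  fixes ev :: "'h::chilbert_space \<Rightarrow> 'x \<Rightarrow> complex"
  assumes ev: "rkhs ev" and A: "bounded_clinear A"
  shows "(norm (A (normalized_kernel ev l)))\<^sup>2 \<le> berezin_norm ev (op_abs A ^^ 2)"
proof -
  let ?k = "normalized_kernel ev"
  let ?f = "\<lambda>(l, m). cmod (cinner ((op_abs A ^^ 2) (?k l)) (?k m))"
  obtain K where K: "0 < K" "\<And>x. norm (A x) \<le> K * norm x"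
    using bounded_clinear_bound[OF A] by blast
  \<comment> \<open>A real supremum dominates its entries only when they are bounded above;
    \<open>K * K\<close> is such a bound on unit vectors.\<close>
  have "?f p \<le> K * K" for p
  proof -
    obtain i j where p: "p = (i, j)"
      by (cases p)
    have "?f p \<le> norm (A (?k i)) * norm (A (?k j))"
      by (simp add: p cinner_op_abs_square[OF A] cmod_cinner_le)
    also have "\<dots> \<le> K * K"
      using K(2)[of "?k i"] K(2)[of "?k j"] K(1)
      by (intro mult_mono) (simp_all add: norm_normalized_kernel[OF ev])
    finally show ?thesis .
  qed
  then have "bdd_above (range ?f)"
    by (auto simp: bdd_above_def)
  then have "?f (l, l) \<le> (SUP p. ?f p)"
    by (intro cSUP_upper) auto
  then show ?thesis
    by (simp add: berezin_norm_def cinner_op_abs_square[OF A] cinner_self norm_power)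
qed

text \<open>Off-diagonal entries are controlled by diagonal ones: Cauchy-Schwarz gives the product
  of two norms, which is at most the mean of their squares.\<close>

lemma berezin_norm_op_abs_le:
  fixes ev :: "'h::chilbert_space \<Rightarrow> 'x \<Rightarrow> complex"
  assumes A: "bounded_clinear A" and c: "\<And>l. (norm (A (normalized_kernel ev l)))\<^sup>2 \<le> c"
  shows "berezin_norm ev (op_abs A ^^ 2) \<le> c"
  unfolding berezin_norm_def
proof (rule cSUP_least)
  fix p :: "'x \<times> 'x"
  obtain i j where p: "p = (i, j)"
    by (cases p)
  let ?a = "norm (A (normalized_kernel ev i))" and ?b = "norm (A (normalized_kernel ev j))"
  have "?a * ?b \<le> c"
    using c[of i] c[of j] sum_squares_bound[of ?a ?b] by linarith
  then show "(case p of (l, m) \<Rightarrow>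
      cmod (cinner ((op_abs A ^^ 2) (normalized_kernel ev l)) (normalized_kernel ev m))) \<le> c"
    using order_trans[OF cmod_cinner_le] by (simp add: p cinner_op_abs_square[OF A])
qed simp

lemma berezin_number_upper:
  fixes ev :: "'h::chilbert_space \<Rightarrow> 'x \<Rightarrow> complex"
  assumes ev: "rkhs ev" and A: "bounded_clinear A"
  shows "cmod (berezin_transform ev A l) \<le> berezin_number ev A"
  unfolding berezin_number_def
proof (rule cSUP_upper)
  obtain K where K: "0 < K" "\<And>x. norm (A x) \<le> K * norm x"
    using bounded_clinear_bound[OF A] by blast
  have "cmod (berezin_transform ev A l) \<le> K" for l
    using cmod_cinner_le[of "A (normalized_kernel ev l)" "normalized_kernel ev l"]
      K(2)[of "normalized_kernel ev l"]
    by (simp add: berezin_transform_def norm_normalized_kernel[OF ev])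
  then show "bdd_above (range (\<lambda>l. cmod (berezin_transform ev A l)))"
    by (auto simp: bdd_above_def)
qed simp

section \<open>The sector inequality and the final estimate\<close>

text \<open>The real part costs at most |z|. The imaginary part costs |z| sin |Arg z|, and sine is
  increasing up to pi/2.\<close>

lemma sector_Re_plus_Im:
  assumes "0 \<le> \<theta>" "\<theta> < pi / 2" "z \<in> sector \<theta>"
  shows "\<bar>Re z + Im z\<bar> \<le> (sin \<theta> + 1) * cmod z"
proof -
  have "\<bar>sin (Arg z)\<bar> = sin \<bar>Arg z\<bar>"
  proof (cases "Arg z \<ge> 0")
    case True
    then show ?thesis
      using Arg_bounded[of z] sin_ge_zero[of "Arg z"] by simp
  next
    case False
    then show ?thesis
      using Arg_bounded[of z] sin_ge_zero[of "- Arg z"] by simp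
  qed
  also have "\<dots> \<le> sin \<theta>"
    using assms by (intro sin_monotone_2pi_le) (auto simp: sector_def)
  finally have "cmod z * \<bar>sin (Arg z)\<bar> \<le> cmod z * sin \<theta>"
    by (intro mult_left_mono) auto
  moreover have "Im z = cmod z * sin (Arg z)"
    by (metis rcis_cmod_Arg Im_rcis)
  ultimately have "\<bar>Im z\<bar> \<le> sin \<theta> * cmod z"
    by (simp add: abs_mult mult.commute)
  then show ?thesis
    using abs_Re_le_cmod[of z] by (simp add: algebra_simps)
qed

theorem theorem3p12:
  fixes ev :: "'h::chilbert_space \<Rightarrow> 'x \<Rightarrow> complex"
    and T :: "'h \<Rightarrow> 'h"
    and \<theta> :: real
  assumes "rkhs ev"
    and "0 \<le> \<theta>" and "\<theta> < pi / 2"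
    and "T \<in> berezin_sectorial ev \<theta>"
  shows "berezin_norm ev (op_abs T ^^ 2)
    \<le> 1 / 4 * (sin \<theta> + 1)\<^sup>2 * (berezin_number ev T)\<^sup>2
      + 1 / 2 * (INF t::real.
          berezin_norm ev (op_abs (\<lambda>x. T x - complex_of_real t *\<^sub>C x) ^^ 2)
        + berezin_norm ev (op_abs (\<lambda>x. T x - (\<i> * complex_of_real t) *\<^sub>C x) ^^ 2))"
    (is "?lhs \<le> ?a + 1 / 2 * (INF t. ?G t)")
proof -
  have T: "bounded_clinear T" and sect: "berezin_transform ev T l \<in> sector \<theta>" for l
    using assms(4) by (auto simp: berezin_sectorial_def berezin_range_def)
  have le: "?lhs \<le> ?a + 1 / 2 * ?G t" for t
  proof (rule berezin_norm_op_abs_le[OF T])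
    fix l
    define k where "k = normalized_kernel ev l"
    define z where "z = cinner (T k) k"
    have k: "norm k = 1"
      by (simp add: k_def norm_normalized_kernel[OF assms(1)])
    have z: "z = berezin_transform ev T l"
      by (simp add: z_def k_def berezin_transform_def)
    have "\<bar>Re z + Im z\<bar> \<le> (sin \<theta> + 1) * cmod z"
      using sector_Re_plus_Im[OF assms(2,3) sect] by (simp add: z)
    also have "\<dots> \<le> (sin \<theta> + 1) * berezin_number ev T"
    proof (rule mult_left_mono)
      show "0 \<le> sin \<theta> + 1"
        using sin_ge_minus_one[of \<theta>] by linarith
    qed (simp add: z berezin_number_upper[OF assms(1) T])
    finally have "(Re z + Im z)\<^sup>2 \<le> ((sin \<theta> + 1) * berezin_number ev T)\<^sup>2"
      using power_mono[of "\<bar>Re z + Im z\<bar>" _ 2] by simp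
    \<comment> \<open>The second shift picks out \<open>Im z\<close> because <T k, \<i> t k> = -
      \<i> t z has real part \<open>t * Im z\<close>.\<close>
    moreover have "(norm (T k - complex_of_real t *\<^sub>C k))\<^sup>2 = (norm (T k))\<^sup>2 - 2 * t * Re z + t\<^sup>2"
      "(norm (T k - (\<i> * complex_of_real t) *\<^sub>C k))\<^sup>2 = (norm (T k))\<^sup>2 - 2 * t * Im z + t\<^sup>2"
      by (simp_all add: norm_diff_sq norm_scaleC k cinner_scaleC_right norm_mult z_def)
    moreover have "(norm (T k - complex_of_real t *\<^sub>C k))\<^sup>2
        + (norm (T k - (\<i> * complex_of_real t) *\<^sub>C k))\<^sup>2 \<le> ?G t"
      using norm_sq_le_berezin_norm[OF assms(1) bounded_clinear_shift[OF T]]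
      unfolding k_def by (intro add_mono)
    \<comment> \<open>Averaging the two expansions leaves exactly this term beyond half their sum;
      completing the square in \<open>t\<close> removes its dependence on \<open>t\<close>.\<close>
    moreover have "t * (Re z + Im z) - t\<^sup>2 \<le> (Re z + Im z)\<^sup>2 / 4"
      using zero_le_power2[of "t - (Re z + Im z) / 2"]
      by (simp add: power2_diff power_divide)
    ultimately show "(norm (T (normalized_kernel ev l)))\<^sup>2 \<le> ?a + 1 / 2 * ?G t"
      unfolding k_def[symmetric] by (simp add: power_mult_distrib distrib_left)
  qed
  \<comment> \<open>Solving the pointwise bound for \<open>?G t\<close> exhibits a lower bound free
    of \<open>t\<close>, which passes to the infimum.\<close>
  have "2 * (?lhs - ?a) \<le> (INF t. ?G t)"
  proof (rule cINF_greatest)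
    show "2 * (?lhs - ?a) \<le> ?G t" for t
      using le[of t] by argo
  qed simp
  then show ?thesis
    by argo
qed

end
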